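(* Let $K=(AP,S,R,s_0,I)$ and $K'$ be Kripke structures such that $K'$ is $x$-bisimilar to $K$ via a relation $\rho$, and let $\varphi$ be a $\mathrm{CTL}^*$ formula not containing $x$. Then $K'\models\varphi$ if and only if $K'\models \mathrm{Prop}(\varphi,K)$, for any propositional simplification $\mathrm{Prop}(\varphi,K)$ of $\varphi$ with respect to $K$.
   Context: A Kripke structure $K=(AP,S,R,s_0,I)$ consists of atomic propositions $AP$, a finite set $S$ of states, a total transition relation $R\subseteq S\times S$, an initial state $s_0$ and labeling $I:S\to 2^{AP}$; $\mathrm{CTL}^*$ has the standard syntax and semantics and $K\models\varphi$ means $K,s_0\models\varphi$. $K'$ is $x$-bisimilar to $K$ (with $x\notin AP$) iff $K'$ has atomic propositions $AP\cup\{x\}$ and there is a relation $\rho\subseteq S\times S'$ with $\rho(s_0,s'_0)$ such that related states agree on $AP$ and each transition from one of two related states is matched by a transition of the other to a related state (in both directions). A propositional simplification $\mathrm{Prop}(\varphi,K)$ of $\varphi$ with respect to $K$ is a formula obtained from $\varphi$ by replacing some state subformulas $\chi$ of $\varphi$ with a propositional formula over $AP$ encoding the set $\|\chi\|^K=\{s\in S\mid K,s\models\chi\}$, i.e., a propositional formula true at exactly the states of $K$ in $\|\chi\|^K$. *)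

theory Defs
  imports Main
begin

section \<open>Kripke structures\<close>

record ('a, 's) kripke =
  AP :: "'a set"
  states :: "'s set"
  trans_rel :: "('s \<times> 's) set"
  init :: 's
  label :: "'s \<Rightarrow> 'a set"

definition kripke_structure :: "('a, 's) kripke \<Rightarrow> bool" where
  "kripke_structure K \<longleftrightarrow>
     finite (states K) \<and>
     trans_rel K \<subseteq> states K \<times> states K \<and>
     (\<forall>s\<in>states K. \<exists>t. (s, t) \<in> trans_rel K) \<and>
     init K \<in> states K \<and>
     (\<forall>s\<in>states K. label K s \<subseteq> AP K)"

definition paths_from :: "('a, 's) kripke \<Rightarrow> 's \<Rightarrow> (nat \<Rightarrow> 's) set" where
  "paths_from K s = {\<pi>. \<pi> 0 = s \<and> (\<forall>i. (\<pi> i, \<pi> (Suc i)) \<in> trans_rel K)}"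

section \<open>CTL*\<close>

text \<open>The constructor \<open>State\<close> embeds state formulas into path formulas. Boolean operators exist
  at both levels, as in the usual two-sorted grammar.\<close>

datatype 'a state_formula =
    STrue
  | SFalse
  | Atom 'a
  | SNot "'a state_formula"
  | SAnd "'a state_formula" "'a state_formula"
  | SOr "'a state_formula" "'a state_formula"
  | Exists "'a path_formula"
  | Forall "'a path_formula"
and 'a path_formula =
    State "'a state_formula"
  | PNot "'a path_formula"
  | PAnd "'a path_formula" "'a path_formula"
  | POr "'a path_formula" "'a path_formula"
  | Next "'a path_formula"
  | Finally "'a path_formula"
  | Globally "'a path_formula"
  | Until "'a path_formula" "'a path_formula"
  | Release "'a path_formula" "'a path_formula"

abbreviation suffix :: "nat \<Rightarrow> (nat \<Rightarrow> 's) \<Rightarrow> nat \<Rightarrow> 's" where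
  "suffix k \<pi> \<equiv> (\<lambda>i. \<pi> (k + i))"

primrec sat_state :: "('a, 's) kripke \<Rightarrow> 's \<Rightarrow> 'a state_formula \<Rightarrow> bool"
  and sat_path :: "('a, 's) kripke \<Rightarrow> (nat \<Rightarrow> 's) \<Rightarrow> 'a path_formula \<Rightarrow> bool" where
  "sat_state K s STrue \<longleftrightarrow> True"
| "sat_state K s SFalse \<longleftrightarrow> False"
| "sat_state K s (Atom p) \<longleftrightarrow> p \<in> label K s"
| "sat_state K s (SNot \<phi>) \<longleftrightarrow> \<not> sat_state K s \<phi>"
| "sat_state K s (SAnd \<phi>1 \<phi>2) \<longleftrightarrow> sat_state K s \<phi>1 \<and> sat_state K s \<phi>2"
| "sat_state K s (SOr \<phi>1 \<phi>2) \<longleftrightarrow> sat_state K s \<phi>1 \<or> sat_state K s \<phi>2"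
| "sat_state K s (Exists \<psi>) \<longleftrightarrow> (\<exists>\<pi>\<in>paths_from K s. sat_path K \<pi> \<psi>)"
| "sat_state K s (Forall \<psi>) \<longleftrightarrow> (\<forall>\<pi>\<in>paths_from K s. sat_path K \<pi> \<psi>)"
| "sat_path K \<pi> (State \<phi>) \<longleftrightarrow> sat_state K (\<pi> 0) \<phi>"
| "sat_path K \<pi> (PNot \<psi>) \<longleftrightarrow> \<not> sat_path K \<pi> \<psi>"
| "sat_path K \<pi> (PAnd \<psi>1 \<psi>2) \<longleftrightarrow> sat_path K \<pi> \<psi>1 \<and> sat_path K \<pi> \<psi>2"
| "sat_path K \<pi> (POr \<psi>1 \<psi>2) \<longleftrightarrow> sat_path K \<pi> \<psi>1 \<or> sat_path K \<pi> \<psi>2"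
| "sat_path K \<pi> (Next \<psi>) \<longleftrightarrow> sat_path K (suffix 1 \<pi>) \<psi>"
| "sat_path K \<pi> (Finally \<psi>) \<longleftrightarrow> (\<exists>k. sat_path K (suffix k \<pi>) \<psi>)"
| "sat_path K \<pi> (Globally \<psi>) \<longleftrightarrow> (\<forall>k. sat_path K (suffix k \<pi>) \<psi>)"
| "sat_path K \<pi> (Until \<psi>1 \<psi>2) \<longleftrightarrow>
     (\<exists>k. sat_path K (suffix k \<pi>) \<psi>2 \<and> (\<forall>j<k. sat_path K (suffix j \<pi>) \<psi>1))"
| "sat_path K \<pi> (Release \<psi>1 \<psi>2) \<longleftrightarrow>
     (\<forall>k. sat_path K (suffix k \<pi>) \<psi>2 \<or> (\<exists>j<k. sat_path K (suffix j \<pi>) \<psi>1))"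

definition models :: "('a, 's) kripke \<Rightarrow> 'a state_formula \<Rightarrow> bool" where
  "models K \<phi> \<longleftrightarrow> sat_state K (init K) \<phi>"

definition sat_set :: "('a, 's) kripke \<Rightarrow> 'a state_formula \<Rightarrow> 's set" where
  "sat_set K \<phi> = {s \<in> states K. sat_state K s \<phi>}"

text \<open>The datatype package generates \<open>set_state_formula\<close>, the set of atomic propositions that
  occur in a formula.\<close>

abbreviation atoms :: "'a state_formula \<Rightarrow> 'a set" where
  "atoms \<equiv> set_state_formula"

section \<open>Bisimilarity up to one proposition\<close>

definition x_bisimilar_via ::
  "'a \<Rightarrow> ('a, 's) kripke \<Rightarrow> ('a, 't) kripke \<Rightarrow> ('s \<times> 't) set \<Rightarrow> bool" where
  "x_bisimilar_via x K K' \<rho> \<longleftrightarrow>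
     x \<notin> AP K \<and>
     AP K' = AP K \<union> {x} \<and>
     \<rho> \<subseteq> states K \<times> states K' \<and>
     (init K, init K') \<in> \<rho> \<and>
     (\<forall>(s, s')\<in>\<rho>.
        label K s \<inter> AP K = label K' s' \<inter> AP K \<and>
        (\<forall>t. (s, t) \<in> trans_rel K \<longrightarrow> (\<exists>t'. (s', t') \<in> trans_rel K' \<and> (t, t') \<in> \<rho>)) \<and>
        (\<forall>t'. (s', t') \<in> trans_rel K' \<longrightarrow> (\<exists>t. (s, t) \<in> trans_rel K \<and> (t, t') \<in> \<rho>)))"

section \<open>Propositional simplification\<close>

inductive propositional :: "'a state_formula \<Rightarrow> bool" where
  "propositional STrue"
| "propositional SFalse"
| "propositional (Atom p)"
| "propositional \<phi> \<Longrightarrow> propositional (SNot \<phi>)"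
| "propositional \<phi>1 \<Longrightarrow> propositional \<phi>2 \<Longrightarrow> propositional (SAnd \<phi>1 \<phi>2)"
| "propositional \<phi>1 \<Longrightarrow> propositional \<phi>2 \<Longrightarrow> propositional (SOr \<phi>1 \<phi>2)"

definition encodes :: "('a, 's) kripke \<Rightarrow> 'a state_formula \<Rightarrow> 's set \<Rightarrow> bool" where
  "encodes K \<theta> X \<longleftrightarrow> propositional \<theta> \<and> atoms \<theta> \<subseteq> AP K \<and> sat_set K \<theta> = X"

text \<open>\<open>prop_simp K \<phi> \<phi>'\<close> holds iff \<open>\<phi>'\<close> arises from \<open>\<phi>\<close> by replacing the state subformulas at some
  (possibly no) pairwise non-nested positions by propositional encodings of their
  satisfaction sets in \<open>K\<close>. Rule \<open>replace\<close> performs a replacement; the remaining rules descend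
  into the formula and leave its unreplaced part untouched.\<close>

inductive prop_simp :: "('a, 's) kripke \<Rightarrow> 'a state_formula \<Rightarrow> 'a state_formula \<Rightarrow> bool"
  and prop_simp_path :: "('a, 's) kripke \<Rightarrow> 'a path_formula \<Rightarrow> 'a path_formula \<Rightarrow> bool"
  for K :: "('a, 's) kripke" where
  replace: "encodes K \<theta> (sat_set K \<chi>) \<Longrightarrow> prop_simp K \<chi> \<theta>"
| "prop_simp K STrue STrue"
| "prop_simp K SFalse SFalse"
| "prop_simp K (Atom p) (Atom p)"
| "prop_simp K \<phi> \<phi>' \<Longrightarrow> prop_simp K (SNot \<phi>) (SNot \<phi>')"
| "prop_simp K \<phi>1 \<phi>1' \<Longrightarrow> prop_simp K \<phi>2 \<phi>2' \<Longrightarrow> prop_simp K (SAnd \<phi>1 \<phi>2) (SAnd \<phi>1' \<phi>2')"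
| "prop_simp K \<phi>1 \<phi>1' \<Longrightarrow> prop_simp K \<phi>2 \<phi>2' \<Longrightarrow> prop_simp K (SOr \<phi>1 \<phi>2) (SOr \<phi>1' \<phi>2')"
| "prop_simp_path K \<psi> \<psi>' \<Longrightarrow> prop_simp K (Exists \<psi>) (Exists \<psi>')"
| "prop_simp_path K \<psi> \<psi>' \<Longrightarrow> prop_simp K (Forall \<psi>) (Forall \<psi>')"
| "prop_simp K \<phi> \<phi>' \<Longrightarrow> prop_simp_path K (State \<phi>) (State \<phi>')"
| "prop_simp_path K \<psi> \<psi>' \<Longrightarrow> prop_simp_path K (PNot \<psi>) (PNot \<psi>')"
| "prop_simp_path K \<psi>1 \<psi>1' \<Longrightarrow> prop_simp_path K \<psi>2 \<psi>2' \<Longrightarrow>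
     prop_simp_path K (PAnd \<psi>1 \<psi>2) (PAnd \<psi>1' \<psi>2')"
| "prop_simp_path K \<psi>1 \<psi>1' \<Longrightarrow> prop_simp_path K \<psi>2 \<psi>2' \<Longrightarrow>
     prop_simp_path K (POr \<psi>1 \<psi>2) (POr \<psi>1' \<psi>2')"
| "prop_simp_path K \<psi> \<psi>' \<Longrightarrow> prop_simp_path K (Next \<psi>) (Next \<psi>')"
| "prop_simp_path K \<psi> \<psi>' \<Longrightarrow> prop_simp_path K (Finally \<psi>) (Finally \<psi>')"
| "prop_simp_path K \<psi> \<psi>' \<Longrightarrow> prop_simp_path K (Globally \<psi>) (Globally \<psi>')"
| "prop_simp_path K \<psi>1 \<psi>1' \<Longrightarrow> prop_simp_path K \<psi>2 \<psi>2' \<Longrightarrow>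
     prop_simp_path K (Until \<psi>1 \<psi>2) (Until \<psi>1' \<psi>2')"
| "prop_simp_path K \<psi>1 \<psi>1' \<Longrightarrow> prop_simp_path K \<psi>2 \<psi>2' \<Longrightarrow>
     prop_simp_path K (Release \<psi>1 \<psi>2) (Release \<psi>1' \<psi>2')"

end

theory Submission
  imports Defs
begin

text \<open>Let \<open>A = AP K\<close>. A formula over \<open>A\<close> cannot distinguish the bisimilar structures \<open>K\<close> and
  \<open>K'\<close>. A propositional simplification is equivalent to the original formula on all states of \<open>K\<close>,
  and is again a formula over \<open>A\<close>. So both formulas can be transferred from \<open>K'\<close> to \<open>K\<close>, where
  they agree.\<close>

text \<open>The path is matched step by step: from the partner already chosen for
  \<open>\<pi> n\<close>, \<open>step\<close> supplies a partner of \<open>\<pi> (Suc n)\<close>,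
  and dependent choice assembles these partners into a path. Assuming a single direction of matching
  lets the lemma serve both for \<open>\<rho>\<close> and for its converse.\<close>

lemma path_lift:
  assumes step: "\<And>s s' t. (s, s') \<in> \<rho> \<Longrightarrow> (s, t) \<in> trans_rel K \<Longrightarrow>
      \<exists>t'. (s', t') \<in> trans_rel K' \<and> (t, t') \<in> \<rho>"
    and rel: "(s, s') \<in> \<rho>" and path: "\<pi> \<in> paths_from K s"
  shows "\<exists>\<pi>'\<in>paths_from K' s'. \<forall>i. (\<pi> i, \<pi>' i) \<in> \<rho>"
proof -
  have start: "\<pi> 0 = s" and trans: "\<And>i. (\<pi> i, \<pi> (Suc i)) \<in> trans_rel K"
    using path by (auto simp: paths_from_def)
  \<comment> \<open>The choice principle prescribes no start, so the invariant pins the value at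
    position \<open>0\<close> to \<open>s'\<close>; at successors this clause is vacuous.\<close>
  have "\<exists>\<pi>'. \<forall>n. ((\<pi> n, \<pi>' n) \<in> \<rho> \<and> (n = 0 \<longrightarrow> \<pi>' n = s')) \<and>
      (\<pi>' n, \<pi>' (Suc n)) \<in> trans_rel K'"
  proof (rule dependent_nat_choice)
    show "\<exists>t'. (\<pi> 0, t') \<in> \<rho> \<and> (0 = (0::nat) \<longrightarrow> t' = s')"
      using start rel by auto
  next
    fix t' and n :: nat
    assume "(\<pi> n, t') \<in> \<rho> \<and> (n = 0 \<longrightarrow> t' = s')"
    then show "\<exists>u'. ((\<pi> (Suc n), u') \<in> \<rho> \<and> (Suc n = 0 \<longrightarrow> u' = s')) \<and>
        (t', u') \<in> trans_rel K'"
      using step[OF _ trans] by blast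
  qed
  then show ?thesis
    unfolding paths_from_def by auto
qed

text \<open>Joint induction on state and path formulas. Paths are compared positionwise, a relation
  inherited by suffixes at equal offsets, which settles the temporal operators; the path quantifiers
  use the transfer of paths in both directions. Labels may differ outside \<open>A\<close>.\<close>

lemma bisimulation_sat:
  fixes K :: "('a, 's) kripke" and K' :: "('a, 't) kripke"
  assumes lab: "\<And>s s'. (s, s') \<in> \<rho> \<Longrightarrow> label K s \<inter> A = label K' s' \<inter> A"
    and zig: "\<And>s s' t. (s, s') \<in> \<rho> \<Longrightarrow> (s, t) \<in> trans_rel K \<Longrightarrow>
      \<exists>t'. (s', t') \<in> trans_rel K' \<and> (t, t') \<in> \<rho>"
    and zag: "\<And>s s' t'. (s, s') \<in> \<rho> \<Longrightarrow> (s', t') \<in> trans_rel K' \<Longrightarrow>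
      \<exists>t. (s, t) \<in> trans_rel K \<and> (t, t') \<in> \<rho>"
  shows sat_state_bisimulation: "atoms \<phi> \<subseteq> A \<Longrightarrow> (s, s') \<in> \<rho> \<Longrightarrow>
      sat_state K s \<phi> \<longleftrightarrow> sat_state K' s' \<phi>"
    and sat_path_bisimulation: "set_path_formula \<psi> \<subseteq> A \<Longrightarrow> (\<And>i. (\<pi> i, \<pi>' i) \<in> \<rho>) \<Longrightarrow>
      sat_path K \<pi> \<psi> \<longleftrightarrow> sat_path K' \<pi>' \<psi>"
proof (induction \<phi> and \<psi> arbitrary: s s' and \<pi> \<pi>')
  have lift: "\<exists>\<pi>'\<in>paths_from K' s'. \<forall>i. (\<pi> i, \<pi>' i) \<in> \<rho>"
    if "(s, s') \<in> \<rho>" "\<pi> \<in> paths_from K s" for s s' \<pi>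
    using path_lift[OF zig that] .
  \<comment> \<open>Path lifting with the structures swapped: for \<open>\<rho>\<inverse>\<close>
    the required matching is \<open>zag\<close>.\<close>
  have lower: "\<exists>\<pi>\<in>paths_from K s. \<forall>i. (\<pi> i, \<pi>' i) \<in> \<rho>"
    if "(s, s') \<in> \<rho>" "\<pi>' \<in> paths_from K' s'" for s s' \<pi>'
    using path_lift[of "\<rho>\<inverse>" K' K s' s \<pi>'] zag that by auto
  {
    case (Exists \<psi>)
    have sub: "set_path_formula \<psi> \<subseteq> A"
      using Exists.prems(1) by simp
    have eq: "sat_path K \<pi> \<psi> = sat_path K' \<pi>' \<psi>"
      if "\<forall>i. (\<pi> i, \<pi>' i) \<in> \<rho>" for \<pi> \<pi>'
      by (rule Exists.IH) (use sub that in auto)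
    \<comment> \<open>A witness path in one structure has a related path in the other, which by
      \<open>eq\<close> is a witness too.\<close>
    show ?case
      unfolding sat_state.simps
      using lift[OF Exists.prems(2)] lower[OF Exists.prems(2)] eq by metis
  next
    case (Forall \<psi>)
    have sub: "set_path_formula \<psi> \<subseteq> A"
      using Forall.prems(1) by simp
    have eq: "sat_path K \<pi> \<psi> = sat_path K' \<pi>' \<psi>"
      if "\<forall>i. (\<pi> i, \<pi>' i) \<in> \<rho>" for \<pi> \<pi>'
      by (rule Forall.IH) (use sub that in auto)
    \<comment> \<open>Dually, a counterexample path is carried across in either direction.\<close>
    show ?case
      unfolding sat_state.simps
      using lift[OF Forall.prems(2)] lower[OF Forall.prems(2)] eq by metis
  }
next
  case (Atom p)
  then show ?case using lab[OF Atom.prems(2)] by auto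
next
  case (SNot \<phi>)
  have "sat_state K s \<phi> = sat_state K' s' \<phi>"
    by (rule SNot.IH) (use SNot.prems in auto)
  then show ?case by simp
next
  case (SAnd \<phi>1 \<phi>2)
  have "sat_state K s \<phi>1 = sat_state K' s' \<phi>1"
    by (rule SAnd.IH) (use SAnd.prems in auto)
  moreover have "sat_state K s \<phi>2 = sat_state K' s' \<phi>2"
    by (rule SAnd.IH) (use SAnd.prems in auto)
  ultimately show ?case by simp
next
  case (SOr \<phi>1 \<phi>2)
  have "sat_state K s \<phi>1 = sat_state K' s' \<phi>1"
    by (rule SOr.IH) (use SOr.prems in auto)
  moreover have "sat_state K s \<phi>2 = sat_state K' s' \<phi>2"
    by (rule SOr.IH) (use SOr.prems in auto)
  ultimately show ?case by simp
next
  case (State \<phi>)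
  have "sat_state K (\<pi> 0) \<phi> = sat_state K' (\<pi>' 0) \<phi>"
    by (rule State.IH) (use State.prems in auto)
  then show ?case by simp
next
  case (PNot \<psi>)
  have "sat_path K \<pi> \<psi> = sat_path K' \<pi>' \<psi>"
    by (rule PNot.IH) (use PNot.prems in auto)
  then show ?case by simp
next
  case (PAnd \<psi>1 \<psi>2)
  have "sat_path K \<pi> \<psi>1 = sat_path K' \<pi>' \<psi>1"
    by (rule PAnd.IH) (use PAnd.prems in auto)
  moreover have "sat_path K \<pi> \<psi>2 = sat_path K' \<pi>' \<psi>2"
    by (rule PAnd.IH) (use PAnd.prems in auto)
  ultimately show ?case by simp
next
  case (POr \<psi>1 \<psi>2)
  have "sat_path K \<pi> \<psi>1 = sat_path K' \<pi>' \<psi>1"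
    by (rule POr.IH) (use POr.prems in auto)
  moreover have "sat_path K \<pi> \<psi>2 = sat_path K' \<pi>' \<psi>2"
    by (rule POr.IH) (use POr.prems in auto)
  ultimately show ?case by simp
next
  case (Next \<psi>)
  have "sat_path K (suffix 1 \<pi>) \<psi> = sat_path K' (suffix 1 \<pi>') \<psi>"
    by (rule Next.IH) (use Next.prems in auto)
  then show ?case unfolding sat_path.simps .
next
  case (Finally \<psi>)
  have "sat_path K (suffix k \<pi>) \<psi> = sat_path K' (suffix k \<pi>') \<psi>" for k
    by (rule Finally.IH) (use Finally.prems in auto)
  then show ?case by simp
next
  case (Globally \<psi>)
  have "sat_path K (suffix k \<pi>) \<psi> = sat_path K' (suffix k \<pi>') \<psi>" for k
    by (rule Globally.IH) (use Globally.prems in auto)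
  then show ?case by simp
next
  case (Until \<psi>1 \<psi>2)
  have "sat_path K (suffix k \<pi>) \<psi>1 = sat_path K' (suffix k \<pi>') \<psi>1" for k
    by (rule Until.IH) (use Until.prems in auto)
  moreover have "sat_path K (suffix k \<pi>) \<psi>2 = sat_path K' (suffix k \<pi>') \<psi>2" for k
    by (rule Until.IH) (use Until.prems in auto)
  ultimately show ?case by simp
next
  case (Release \<psi>1 \<psi>2)
  have "sat_path K (suffix k \<pi>) \<psi>1 = sat_path K' (suffix k \<pi>') \<psi>1" for k
    by (rule Release.IH) (use Release.prems in auto)
  moreover have "sat_path K (suffix k \<pi>) \<psi>2 = sat_path K' (suffix k \<pi>') \<psi>2" for k
    by (rule Release.IH) (use Release.prems in auto)
  ultimately show ?case by simp
qed simp_all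

lemma paths_from_states:
  assumes "kripke_structure K" "\<pi> \<in> paths_from K s"
  shows "\<pi> i \<in> states K"
  using assms unfolding kripke_structure_def paths_from_def by blast

text \<open>A replaced subformula and its encoding have equal satisfaction sets, which are subsets
  of \<open>states K\<close>; hence the restriction to such states. Equivalence then propagates
  through all constructors, since paths from a state never leave \<open>states K\<close>.\<close>

lemma prop_simp_sat:
  assumes K: "kripke_structure K"
  shows prop_simp_sat_state: "prop_simp K \<phi> \<phi>' \<Longrightarrow> s \<in> states K \<Longrightarrow>
      sat_state K s \<phi> \<longleftrightarrow> sat_state K s \<phi>'"
    and prop_simp_path_sat_path: "prop_simp_path K \<psi> \<psi>' \<Longrightarrow> (\<And>i. \<pi> i \<in> states K) \<Longrightarrow>
      sat_path K \<pi> \<psi> \<longleftrightarrow> sat_path K \<pi> \<psi>'"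
proof (induction arbitrary: s and \<pi> rule: prop_simp_prop_simp_path.inducts)
  case (replace \<theta> \<chi>)
  then show ?case by (auto simp: encodes_def sat_set_def)
qed (simp_all add: paths_from_states[OF K])

text \<open>Encodings are formulas over \<open>AP K\<close>, and the other rules introduce no new
  atoms. This makes bisimulation invariance available for the simplified formula as well.\<close>

lemma prop_simp_atoms:
  "prop_simp K \<phi> \<phi>' \<Longrightarrow> atoms \<phi> \<subseteq> AP K \<Longrightarrow> atoms \<phi>' \<subseteq> AP K"
  "prop_simp_path K \<psi> \<psi>' \<Longrightarrow> set_path_formula \<psi> \<subseteq> AP K \<Longrightarrow> set_path_formula \<psi>' \<subseteq> AP K"
  by (induction rule: prop_simp_prop_simp_path.inducts) (auto simp: encodes_def)

theorem theorem4p10: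
  fixes K :: "('a, 's) kripke" and K' :: "('a, 't) kripke"
    and x :: 'a and \<rho> :: "('s \<times> 't) set"
    and \<phi> \<phi>' :: "'a state_formula"
  assumes "kripke_structure K" and "kripke_structure K'"
    and "x_bisimilar_via x K K' \<rho>"
    and "atoms \<phi> \<subseteq> AP K'" and "x \<notin> atoms \<phi>"
    and "prop_simp K \<phi> \<phi>'"
  shows "models K' \<phi> \<longleftrightarrow> models K' \<phi>'"
proof -
  \<comment> \<open>Related states may disagree on \<open>x\<close>, so the transfer is confined to
    formulas over \<open>AP K\<close>.\<close>
  have bisim: "models K \<chi> \<longleftrightarrow> models K' \<chi>" if "atoms \<chi> \<subseteq> AP K" for \<chi>
    unfolding models_def
    by (rule sat_state_bisimulation[where \<rho> = \<rho> and A = "AP K"])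
      (use assms(3) that in \<open>auto simp: x_bisimilar_via_def\<close>)
  \<comment> \<open>\<open>x\<close> is the only proposition of \<open>K'\<close> outside
    \<open>AP K\<close>, and \<open>\<phi>\<close> omits it.\<close>
  have "atoms \<phi> \<subseteq> AP K"
    using assms(3-5) by (auto simp: x_bisimilar_via_def)
  moreover from this have "atoms \<phi>' \<subseteq> AP K"
    using assms(6) by (rule prop_simp_atoms(1)[rotated])
  moreover have "models K \<phi> \<longleftrightarrow> models K \<phi>'"
    unfolding models_def
    by (rule prop_simp_sat_state) (use assms in \<open>auto simp: kripke_structure_def\<close>)
  ultimately show ?thesis
    using bisim by simp
qed

end
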